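(* If $n\geq 1$, then $$A_n(1,-1)=|\mathcal{R}_n^{(e)}|-|\mathcal{R}_n^{(o)}|=B_n^*-B_{n+1}^*.$$
   Context: Permutations $\pi=\pi_1\cdots\pi_n$ of $[n]=\{1,\ldots,n\}$ are written in one-line notation. $\mathrm{inv}(\pi)$ is the number of pairs $(i,j)$ with $1\le i<j\le n$ and $\pi_i>\pi_j$. A run of $\pi$ is a maximal increasing sequence of consecutive entries; $\mathrm{run}(\pi)$ is the number of runs. A permutation is run-sorted if $\pi_1=1$ and the first entries of its runs, read from left to right, form an increasing sequence. $\mathcal{R}_n$ denotes the set of run-sorted permutations of $[n]$, and $A_n(q,u)=\sum_{\pi\in\mathcal{R}_n}q^{\mathrm{inv}(\pi)}u^{\mathrm{run}(\pi)}$. $\mathcal{R}_n^{(e)}$ and $\mathcal{R}_n^{(o)}$ denote the subsets of $\mathcal{R}_n$ whose members have an even, respectively odd, number of runs. $B_n^*$ denotes the $n$-th complementary Bell number, defined by $B_0^*=1$ and $B_{n+1}^*=-\sum_{i=0}^n\binom{n}{i}B_i^*$ for $n\geq 0$. *)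

theory Defs
  imports "HOL-Combinatorics.Combinatorics"
begin

text \<open>
  A permutation of \<open>[n]\<close> is represented by its one-line notation, a list in
  \<open>permutations_of_set {1..n}\<close>. List positions count from \<open>0\<close>, so \<open>\<pi> ! i\<close> is the entry
  with index \<open>i + 1\<close>.
\<close>

definition inv_count :: "nat list \<Rightarrow> nat" where
  "inv_count \<pi> = card {(i, j). i < j \<and> j < length \<pi> \<and> \<pi> ! i > \<pi> ! j}"

definition increasing_segment :: "nat list \<Rightarrow> nat \<Rightarrow> nat \<Rightarrow> bool" where
  "increasing_segment \<pi> i j \<longleftrightarrow>
     i \<le> j \<and> j < length \<pi> \<and> strict_mono_on {i..j} (\<lambda>k. \<pi> ! k)"

text \<open>
  A run is recorded by the pair of its first and last position; maximality is with respect
  to inclusion of segments.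
\<close>

definition runs :: "nat list \<Rightarrow> (nat \<times> nat) set" where
  "runs \<pi> = {(i, j). increasing_segment \<pi> i j \<and>
     (\<forall>i' j'. increasing_segment \<pi> i' j' \<and> i' \<le> i \<and> j \<le> j' \<longrightarrow> i' = i \<and> j' = j)}"

definition run_count :: "nat list \<Rightarrow> nat" where
  "run_count \<pi> = card (runs \<pi>)"

definition run_sorted :: "nat list \<Rightarrow> bool" where
  "run_sorted \<pi> \<longleftrightarrow> \<pi> \<noteq> [] \<and> \<pi> ! 0 = 1 \<and>
     (\<forall>(i, j) \<in> runs \<pi>. \<forall>(i', j') \<in> runs \<pi>. i < i' \<longrightarrow> \<pi> ! i < \<pi> ! i')"

definition RS :: "nat \<Rightarrow> nat list set" where
  "RS n = {\<pi> \<in> permutations_of_set {1..n}. run_sorted \<pi>}"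

definition RS_even :: "nat \<Rightarrow> nat list set" where
  "RS_even n = {\<pi> \<in> RS n. even (run_count \<pi>)}"

definition RS_odd :: "nat \<Rightarrow> nat list set" where
  "RS_odd n = {\<pi> \<in> RS n. odd (run_count \<pi>)}"

definition A :: "nat \<Rightarrow> 'a::comm_semiring_1 \<Rightarrow> 'a \<Rightarrow> 'a" where
  "A n q u = (\<Sum>\<pi>\<in>RS n. q ^ inv_count \<pi> * u ^ run_count \<pi>)"

fun compl_bell :: "nat \<Rightarrow> int" where
  "compl_bell 0 = 1"
| "compl_bell (Suc n) = - (\<Sum>i\<le>n. int (n choose i) * compl_bell i)"

end

theory Submission
  imports Defs
begin

text \<open>
  For a finite set \<open>T\<close> of naturals let \<open>F(T)\<close> be the sum of \<open>u\<close> to the number of runs over all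
  arrangements of \<open>T\<close> whose runs have increasing first entries, with \<open>F(\<emptyset>) = 1\<close>; thus
  \<open>F({1..n}) = A\<^sub>n(1,u)\<close>. Such an arrangement of a nonempty \<open>T\<close> is its first run followed by an
  arrangement of the same kind of the remaining set \<open>S\<close>. The first run is \<open>T - S\<close> in increasing
  order, so \<open>S\<close> and the arrangement of \<open>S\<close> determine everything. The first run must contain
  \<open>Min T\<close> and, if \<open>S\<close> is nonempty, must be followed by a descent. The entry after the first run
  is \<open>Min S\<close>, so the descent excludes precisely the sets \<open>S\<close> lying entirely above \<open>T - S\<close>, that
  is, the upper sections \<open>{x \<in> T. s \<le> x}\<close> with \<open>s \<in> T - {Min T}\<close>
  (\<open>bij_betw_split_first_run\<close>, \<open>later_runs_sets_eq\<close>). Hence \<open>F(T) = u \<Sum>\<^sub>S F(S)\<close> over the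
  remaining sets \<open>S\<close> (\<open>run_polynomial_recurrence\<close>).

  Now let \<open>u = -1\<close>, let \<open>B\<close> be the complementary Bell numbers and \<open>b m = B m - B (m + 1)\<close>. By
  induction \<open>F(S) = b (card S)\<close> for the nonempty sets \<open>S\<close> of the recurrence, while
  \<open>F(\<emptyset>) = b 0 - 1\<close>. There are \<open>k choose m\<close> subsets of \<open>T - {Min T}\<close> of size \<open>m\<close>, where
  \<open>card T = k + 1\<close>, and one excluded upper section of each size from \<open>1\<close> to \<open>k\<close>, so
  \<open>F(T) = 1 - (\<Sum>m\<le>k. (k choose m) * b m) + (\<Sum>m=1..k. b m)\<close>.
  The last sum telescopes to \<open>-1 - B (k + 1)\<close>. The recurrence that defines \<open>B\<close>, applied to the
  terms \<open>B m\<close> of the first sum, leaves \<open>F(T) = \<Sum>m\<le>k. (k choose m) * B (m + 1)\<close>, and by Pascal's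
  rule this is \<open>b (k + 1)\<close> (\<open>compl_bell_diff\<close>).
\<close>

section \<open>Runs and their first positions\<close>

text \<open>
  The case \<open>i = 0\<close> has to be separate because \<open>0 - 1 = 0\<close>. For repeated entries the weak
  inequality is the right one, since runs are strictly increasing.
\<close>

definition run_starts :: "nat list \<Rightarrow> nat set" where
  "run_starts xs = {i. i < length xs \<and> (i = 0 \<or> xs ! i \<le> xs ! (i - 1))}"

lemma finite_run_starts [simp]: "finite (run_starts xs)"
  unfolding run_starts_def by simp

lemma run_starts_Nil [simp]: "run_starts [] = {}"
  unfolding run_starts_def by simp

lemma zero_in_run_starts_iff [simp]: "0 \<in> run_starts xs \<longleftrightarrow> xs \<noteq> []"
  unfolding run_starts_def by simp

lemma increasing_segment_extend_left:
  assumes "increasing_segment xs i j" "i > 0" "xs ! (i - 1) < xs ! i"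
  shows "increasing_segment xs (i - 1) j"
proof -
  have mono: "xs ! a < xs ! b" if "a \<in> {i..j}" "b \<in> {i..j}" "a < b" for a b
    using assms(1) that unfolding increasing_segment_def strict_mono_on_def by blast
  have "xs ! a < xs ! b" if ab: "a \<in> {i - 1..j}" "b \<in> {i - 1..j}" "a < b" for a b
  proof (cases "a = i - 1")
    case True
    show ?thesis
    proof (cases "b = i")
      case False
      with True ab have "xs ! i < xs ! b" by (intro mono) auto
      with True assms(3) show ?thesis by simp
    qed (use True assms(3) in simp)
  next
    case False
    then show ?thesis using mono ab by auto
  qed
  then show ?thesis
    using assms(1) unfolding increasing_segment_def strict_mono_on_def by auto
qed

text \<open>
  A maximal increasing segment cannot be extended to the left, so it begins at a position of
  \<open>run_starts\<close>; conversely, the longest increasing segment that begins at such a position is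
  maximal. This replaces the two-ended runs by a set of positions that behaves well when lists are
  concatenated.
\<close>

lemma bij_betw_fst_runs: "bij_betw fst (runs xs) (run_starts xs)"
proof -
  have "inj_on fst (runs xs)"
  proof (rule inj_onI, clarify)
    fix i j i' j' assume r: "(i, j) \<in> runs xs" "(i', j') \<in> runs xs" and "fst (i, j) = fst (i', j')"
    then have "i = i'" by simp
    with r show "i = i' \<and> j = j'"
      using nat_le_linear[of j j'] unfolding runs_def by blast
  qed
  moreover have "fst ` runs xs = run_starts xs"
  proof (intro equalityI subsetI)
    fix i assume "i \<in> fst ` runs xs"
    then obtain j where r: "(i, j) \<in> runs xs" by auto
    then have seg: "increasing_segment xs i j"
      and max: "\<And>i' j'. increasing_segment xs i' j' \<Longrightarrow> i' \<le> i \<Longrightarrow> j \<le> j' \<Longrightarrow> i' = i"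
      unfolding runs_def by auto
    have "i = 0 \<or> xs ! i \<le> xs ! (i - 1)"
      using increasing_segment_extend_left[OF seg] max[of "i - 1" j] by force
    with seg show "i \<in> run_starts xs"
      unfolding run_starts_def increasing_segment_def by auto
  next
    fix i assume i: "i \<in> run_starts xs"
    define J where "J = {j. increasing_segment xs i j}"
    have fin: "finite J"
      by (rule finite_subset[of _ "{..<length xs}"]) (auto simp: J_def increasing_segment_def)
    have "i \<in> J"
      using i by (auto simp: J_def increasing_segment_def run_starts_def strict_mono_on_def)
    then have seg: "increasing_segment xs i (Max J)"
      using Max_in[OF fin] by (auto simp: J_def)
    have "i' = i \<and> j' = Max J"
      if s: "increasing_segment xs i' j'" and le: "i' \<le> i" "Max J \<le> j'" for i' j'
    proof -
      have "i' = i"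
      proof (rule ccontr)
        assume "i' \<noteq> i"
        moreover have "i \<le> j'"
          using seg le unfolding increasing_segment_def by simp
        ultimately have "i - 1 \<in> {i'..j'}" "i \<in> {i'..j'}" "i - 1 < i" using le by auto
        then have "xs ! (i - 1) < xs ! i"
          using s unfolding increasing_segment_def strict_mono_on_def by blast
        with i \<open>i' \<noteq> i\<close> le show False unfolding run_starts_def by auto
      qed
      with s have "j' \<in> J" by (simp add: J_def)
      with \<open>i' = i\<close> le show ?thesis using Max_ge[OF fin] by force
    qed
    with seg have "(i, Max J) \<in> runs xs" unfolding runs_def by auto
    then show "i \<in> fst ` runs xs" by force
  qed
  ultimately show ?thesis by (simp add: bij_betw_def)
qed

lemma run_count_eq: "run_count xs = card (run_starts xs)"
  unfolding run_count_def using bij_betw_fst_runs by (rule bij_betw_same_card)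

section \<open>Words with increasing first entries of runs\<close>

definition starts_increasing :: "nat list \<Rightarrow> bool" where
  "starts_increasing xs \<longleftrightarrow> strict_mono_on (run_starts xs) (\<lambda>i. xs ! i)"

lemma starts_increasing_Nil [simp]: "starts_increasing []"
  unfolding starts_increasing_def by (simp add: strict_mono_on_def)

text \<open>
  Every entry is at least the first entry of its own run, and that is at least the first entry of
  the first run. Hence an arrangement of \<open>{1..n}\<close> with increasing first entries of runs begins with
  \<open>1\<close> automatically, and the recursion need not carry a condition on the first entry.
\<close>

lemma hd_le_of_starts_increasing:
  assumes "starts_increasing xs" "x \<in> set xs"
  shows "hd xs \<le> x"
proof -
  have "\<exists>s \<in> run_starts xs. xs ! s \<le> xs ! i" if "i < length xs" for i
    using that
  proof (induction i)
    case 0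
    then have "0 \<in> run_starts xs" by auto
    then show ?case by blast
  next
    case (Suc i)
    show ?case
    proof (cases "Suc i \<in> run_starts xs")
      case True
      then show ?thesis by blast
    next
      case False
      with Suc.prems have "xs ! i < xs ! Suc i" by (auto simp: run_starts_def)
      moreover obtain s where "s \<in> run_starts xs" "xs ! s \<le> xs ! i"
        using Suc.IH Suc.prems by auto
      ultimately show ?thesis by (intro bexI[of _ s]) auto
    qed
  qed
  moreover obtain i where "i < length xs" "x = xs ! i"
    using assms(2) by (metis in_set_conv_nth)
  ultimately obtain s where s: "s \<in> run_starts xs" "xs ! s \<le> x" by blast
  have ne: "xs \<noteq> []" using assms(2) by auto
  then have "xs ! 0 \<le> xs ! s"
    using assms(1) s(1) unfolding starts_increasing_def strict_mono_on_def
    by (cases "s = 0") (auto intro!: less_imp_le)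
  with s ne show ?thesis by (simp add: hd_conv_nth)
qed

lemma run_sorted_iff:
  "run_sorted xs \<longleftrightarrow> xs \<noteq> [] \<and> hd xs = 1 \<and> starts_increasing xs"
proof -
  have "(\<forall>(i, j) \<in> runs xs. \<forall>(i', j') \<in> runs xs. i < i' \<longrightarrow> xs ! i < xs ! i')
    \<longleftrightarrow> (\<forall>i \<in> fst ` runs xs. \<forall>i' \<in> fst ` runs xs. i < i' \<longrightarrow> xs ! i < xs ! i')"
    by force
  also have "fst ` runs xs = run_starts xs"
    using bij_betw_fst_runs by (rule bij_betw_imp_surj_on)
  finally show ?thesis
    unfolding run_sorted_def starts_increasing_def strict_mono_on_def
    by (cases "xs = []") (auto simp: hd_conv_nth)
qed

definition run_sorted_words :: "nat set \<Rightarrow> nat list set" where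
  "run_sorted_words T = {xs \<in> permutations_of_set T. starts_increasing xs}"

lemma finite_run_sorted_words [simp]: "finite (run_sorted_words T)"
  unfolding run_sorted_words_def by simp

lemma run_sorted_words_empty [simp]: "run_sorted_words {} = {[]}"
  unfolding run_sorted_words_def by auto

lemma hd_run_sorted_words:
  assumes "xs \<in> run_sorted_words T" "T \<noteq> {}"
  shows "hd xs = Min T"
proof -
  have set: "set xs = T" and inc: "starts_increasing xs"
    using assms by (auto simp: run_sorted_words_def permutations_of_set_def)
  with assms(2) have "hd xs \<in> T" by (metis hd_in_set set_empty)
  then show ?thesis
    using hd_le_of_starts_increasing[OF inc] set by (metis List.finite_set Min_eqI)
qed

lemma RS_eq_run_sorted_words:
  assumes "n \<ge> 1"
  shows "RS n = run_sorted_words {1..n}"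
proof -
  have "xs \<noteq> [] \<and> hd xs = 1" if "xs \<in> run_sorted_words {1..n}" for xs
  proof -
    have "set xs = {1..n}"
      using that by (auto simp: run_sorted_words_def permutations_of_set_def)
    moreover have "Min {1..n} = 1" using assms by (intro Min_eqI) auto
    ultimately show ?thesis using hd_run_sorted_words[OF that] assms by auto
  qed
  then show ?thesis
    unfolding RS_def run_sorted_words_def by (auto simp: run_sorted_iff)
qed

section \<open>Splitting off the first run\<close>

lemma run_starts_append:
  assumes "ys \<noteq> []" "sorted_wrt (<) ys" "zs \<noteq> [] \<longrightarrow> hd zs \<le> last ys"
  shows "run_starts (ys @ zs) = insert 0 ((+) (length ys) ` run_starts zs)"
proof (intro equalityI subsetI)
  fix i assume i: "i \<in> run_starts (ys @ zs)"
  show "i \<in> insert 0 ((+) (length ys) ` run_starts zs)"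
  proof (cases "i < length ys")
    case True
    have "ys ! (i - 1) < ys ! i" if "i > 0"
      using that True by (intro sorted_wrt_nth_less[OF assms(2)]) auto
    with i True have "i = 0" by (cases i) (auto simp: run_starts_def nth_append)
    then show ?thesis by simp
  next
    case False
    then obtain k where "i = length ys + k" using le_Suc_ex not_less by blast
    moreover from this have "k \<in> run_starts zs"
      using i assms(1) by (cases k) (auto simp: run_starts_def nth_append)
    ultimately show ?thesis by blast
  qed
next
  fix i assume "i \<in> insert 0 ((+) (length ys) ` run_starts zs)"
  then consider "i = 0" | k where "k \<in> run_starts zs" "i = length ys + k" by auto
  then show "i \<in> run_starts (ys @ zs)"
  proof cases
    case 1
    then show ?thesis using assms(1) by simp
  next
    case 2
    show ?thesis
    proof (cases k)
      case 0
      with 2 have "zs \<noteq> []" by auto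
      with assms(1,3) have "zs ! 0 \<le> ys ! (length ys - 1)"
        by (simp add: hd_conv_nth last_conv_nth)
      with 0 2 \<open>zs \<noteq> []\<close> assms(1) show ?thesis by (auto simp: run_starts_def nth_append)
    next
      case (Suc m)
      with 2 assms(1) show ?thesis by (auto simp: run_starts_def nth_append)
    qed
  qed
qed

lemma card_run_starts_append:
  assumes "ys \<noteq> []" "sorted_wrt (<) ys" "zs \<noteq> [] \<longrightarrow> hd zs \<le> last ys"
  shows "card (run_starts (ys @ zs)) = Suc (card (run_starts zs))"
proof -
  have "0 \<notin> (+) (length ys) ` run_starts zs" using assms(1) by auto
  then show ?thesis
    by (simp add: run_starts_append[OF assms] card_image)
qed

lemma starts_increasing_append_iff:
  assumes "ys \<noteq> []" "sorted_wrt (<) ys" "zs \<noteq> [] \<longrightarrow> hd zs \<le> last ys"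
  shows "starts_increasing (ys @ zs) \<longleftrightarrow>
    starts_increasing zs \<and> (zs \<noteq> [] \<longrightarrow> hd ys < hd zs)"
proof -
  have hd: "(ys @ zs) ! 0 = hd ys" using assms(1) by (simp add: nth_append hd_conv_nth)
  have "starts_increasing (ys @ zs) \<longleftrightarrow>
    starts_increasing zs \<and> (\<forall>k \<in> run_starts zs. hd ys < zs ! k)"
  proof
    assume inc: "starts_increasing (ys @ zs)"
    have "(ys @ zs) ! i < (ys @ zs) ! j"
      if "i \<in> insert 0 ((+) (length ys) ` run_starts zs)"
        "j \<in> insert 0 ((+) (length ys) ` run_starts zs)" "i < j" for i j
      using inc that unfolding starts_increasing_def run_starts_append[OF assms] strict_mono_on_def
      by blast
    note this[of "length ys + k" "length ys + l" for k l] this[of 0 "length ys + k" for k]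
    with assms(1) hd show "starts_increasing zs \<and> (\<forall>k \<in> run_starts zs. hd ys < zs ! k)"
      unfolding starts_increasing_def strict_mono_on_def by simp
  next
    assume "starts_increasing zs \<and> (\<forall>k \<in> run_starts zs. hd ys < zs ! k)"
    with assms(1) hd show "starts_increasing (ys @ zs)"
      unfolding starts_increasing_def run_starts_append[OF assms] strict_mono_on_def by auto
  qed
  moreover have "(\<forall>k \<in> run_starts zs. hd ys < zs ! k) \<longleftrightarrow> (zs \<noteq> [] \<longrightarrow> hd ys < hd zs)"
    if inc: "starts_increasing zs"
  proof (cases "zs = []")
    case False
    have "hd zs \<le> zs ! k" if "k \<in> run_starts zs" for k
      using that hd_le_of_starts_increasing[OF inc] by (simp add: run_starts_def)
    moreover have "0 \<in> run_starts zs" "zs ! 0 = hd zs" using False by (auto simp: hd_conv_nth)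
    ultimately show ?thesis using False by (metis order_less_le_trans)
  qed simp
  ultimately show ?thesis by blast
qed

text \<open>
  Together with the next lemma: a nonempty list factors in exactly one way into a nonempty
  increasing list and a rest that does not prolong it.
\<close>

lemma first_run_exists:
  fixes xs :: "'b::linorder list"
  assumes "xs \<noteq> []"
  shows "\<exists>ys zs. xs = ys @ zs \<and> ys \<noteq> [] \<and> sorted_wrt (<) ys \<and> (zs \<noteq> [] \<longrightarrow> hd zs \<le> last ys)"
  using assms
proof (induction xs)
  case (Cons x xs)
  show ?case
  proof (cases "xs = [] \<or> hd xs \<le> x")
    case True
    then show ?thesis by (intro exI[of _ "[x]"] exI[of _ xs]) auto
  next
    case False
    then obtain ys zs where split: "xs = ys @ zs" "ys \<noteq> []" "sorted_wrt (<) ys"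
      "zs \<noteq> [] \<longrightarrow> hd zs \<le> last ys" using Cons.IH by blast
    from False split(1,2) have "x < hd ys" by auto
    with split(2,3) have "sorted_wrt (<) (x # ys)" by (cases ys) auto
    with split show ?thesis by (intro exI[of _ "x # ys"] exI[of _ zs]) auto
  qed
qed simp

text \<open>
  If \<open>ys'\<close> were longer than \<open>ys\<close>, it would contain the non-ascent from \<open>last ys\<close> to \<open>hd zs\<close>. Used
  in both directions, this fixes the length of the first run and so gives injectivity of the
  decomposition.
\<close>

lemma first_run_length_le:
  fixes ys' :: "'b::linorder list"
  assumes "ys @ zs = ys' @ zs'" "ys \<noteq> []" "zs \<noteq> [] \<longrightarrow> hd zs \<le> last ys"
    and "sorted_wrt (<) ys'"
  shows "length ys' \<le> length ys"
proof (rule ccontr)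
  assume "\<not> length ys' \<le> length ys"
  then have less: "length ys < length ys'" by simp
  have ne: "zs \<noteq> []" using assms(1) less by auto
  have "ys' ! (length ys - 1) < ys' ! length ys"
    using assms(2,4) less by (intro sorted_wrt_nth_less) auto
  moreover have "ys' ! (length ys - 1) = last ys" "ys' ! length ys = hd zs"
    using arg_cong[OF assms(1), of "\<lambda>l. l ! (length ys - 1)"]
      arg_cong[OF assms(1), of "\<lambda>l. l ! length ys"] less ne assms(2)
    by (simp_all add: nth_append last_conv_nth hd_conv_nth split: if_splits)
  ultimately show False using assms(3) ne by simp
qed

text \<open>
  The possible sets of entries outside the first run of an arrangement of \<open>T\<close>. The first run ends
  with \<open>Max (T - S)\<close> and the second begins with \<open>Min S\<close>, so the inequality is the descent between
  them.
\<close>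

definition later_runs_sets :: "nat set \<Rightarrow> nat set set" where
  "later_runs_sets T = {S. S \<subseteq> T - {Min T} \<and> (S \<noteq> {} \<longrightarrow> Min S < Max (T - S))}"

definition run_polynomial :: "'a::comm_ring_1 \<Rightarrow> nat set \<Rightarrow> 'a" where
  "run_polynomial u T = (\<Sum>xs\<in>run_sorted_words T. u ^ card (run_starts xs))"

lemma run_polynomial_empty [simp]: "run_polynomial u {} = 1"
  unfolding run_polynomial_def by simp

lemma prepend_first_run:
  assumes "finite T" "T \<noteq> {}" "S \<in> later_runs_sets T" "zs \<in> run_sorted_words S"
  defines "ys \<equiv> sorted_list_of_set (T - S)"
  shows "ys \<noteq> []" "sorted_wrt (<) ys" "set ys = T - S" "set zs = S"
    "zs \<noteq> [] \<longrightarrow> hd zs \<le> last ys" "ys @ zs \<in> run_sorted_words T"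
proof -
  have S: "S \<subseteq> T - {Min T}" "S \<noteq> {} \<Longrightarrow> Min S < Max (T - S)"
    using assms(3) by (auto simp: later_runs_sets_def)
  have zs: "set zs = S" "distinct zs" "starts_increasing zs"
    using assms(4) by (auto simp: run_sorted_words_def permutations_of_set_def)
  have minT: "Min T \<in> T - S" using assms(1,2) S(1) by auto
  have set: "set ys = T - S" using assms(1) by (simp add: ys_def)
  have sorted: "sorted_wrt (<) ys" by (simp add: ys_def)
  have ne: "ys \<noteq> []" using set minT by auto
  have hd: "hd ys = Min T"
  proof -
    have "hd ys = Min (T - S)"
      using assms(1) minT by (metis empty_iff finite_Diff sorted_list_of_set_nonempty ys_def list.sel(1))
    also have "\<dots> = Min T" using assms(1) minT by (intro Min_eqI) auto
    finally show ?thesis .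
  qed
  have hdzs: "hd zs = Min S" "S \<noteq> {}" if "zs \<noteq> []"
    using that hd_run_sorted_words[OF assms(4)] zs(1) by auto
  have desc: "zs \<noteq> [] \<longrightarrow> hd zs \<le> last ys"
  proof
    assume "zs \<noteq> []"
    have "Max (T - S) \<le> last ys"
    proof -
      have "Max (T - S) \<in> set ys" using set assms(1) minT Max_in[of "T - S"] by auto
      moreover have "x \<le> last ys" if "x \<in> set ys" for x
      proof -
        have "ys = butlast ys @ [last ys]" using ne by simp
        with sorted that show ?thesis
          by (metis (no_types) Un_iff empty_iff empty_set list.set_intros(1) order.refl order_less_imp_le
              set_ConsD set_append sorted_wrt_append)
      qed
      ultimately show ?thesis by blast
    qed
    then show "hd zs \<le> last ys" using hdzs[OF \<open>zs \<noteq> []\<close>] S(2) by simp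
  qed
  have "hd ys < hd zs" if "zs \<noteq> []"
  proof -
    have "hd zs \<in> T - {Min T}" using that zs(1) S(1) by (meson hd_in_set subsetD)
    then show ?thesis using hd assms(1) by (metis DiffE Min_le insertI1 order_le_less)
  qed
  then have "starts_increasing (ys @ zs)"
    using starts_increasing_append_iff[OF ne sorted desc] zs(3) by blast
  moreover have "ys @ zs \<in> permutations_of_set T"
    using set zs S(1) sorted by (auto simp: permutations_of_set_def ys_def)
  ultimately show "ys @ zs \<in> run_sorted_words T" by (simp add: run_sorted_words_def)
  show "ys \<noteq> []" "sorted_wrt (<) ys" "set ys = T - S" "set zs = S"
    "zs \<noteq> [] \<longrightarrow> hd zs \<le> last ys" by fact+
qed

lemma bij_betw_split_first_run:
  assumes "finite T" "T \<noteq> {}"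
  shows "bij_betw (\<lambda>(S, zs). sorted_list_of_set (T - S) @ zs)
    (SIGMA S:later_runs_sets T. run_sorted_words S) (run_sorted_words T)"
proof -
  let ?f = "\<lambda>(S, zs). sorted_list_of_set (T - S) @ zs"
  let ?P = "SIGMA S:later_runs_sets T. run_sorted_words S"
  note facts = prepend_first_run[OF assms]
  have "inj_on ?f ?P"
  proof (rule inj_onI, clarify)
    fix S zs S' zs'
    assume S: "S \<in> later_runs_sets T" "zs \<in> run_sorted_words S"
      and S': "S' \<in> later_runs_sets T" "zs' \<in> run_sorted_words S'"
      and eq: "sorted_list_of_set (T - S) @ zs = sorted_list_of_set (T - S') @ zs'"
    note F = facts[OF S] and F' = facts[OF S']
    have "length (sorted_list_of_set (T - S)) = length (sorted_list_of_set (T - S'))"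
      using first_run_length_le[OF eq F(1) F(5) F'(2)]
        first_run_length_le[OF eq[symmetric] F'(1) F'(5) F(2)] by (rule le_antisym[rotated])
    with eq have "zs = zs'" by simp
    with F(4) F'(4) show "S = S' \<and> zs = zs'" by simp
  qed
  moreover have "?f ` ?P \<subseteq> run_sorted_words T" using facts(6) by auto
  moreover have "xs \<in> ?f ` ?P" if xs: "xs \<in> run_sorted_words T" for xs
  proof -
    have set: "set xs = T" and dist: "distinct xs" and inc: "starts_increasing xs"
      using xs by (auto simp: run_sorted_words_def permutations_of_set_def)
    then have "xs \<noteq> []" using assms(2) by auto
    then obtain ys zs where split: "xs = ys @ zs" "ys \<noteq> []" "sorted_wrt (<) ys"
      "zs \<noteq> [] \<longrightarrow> hd zs \<le> last ys" using first_run_exists by blast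
    have ysT: "set ys = T - set zs" using set dist split(1) by auto
    have ys: "sorted_list_of_set (T - set zs) = ys"
      using split(3) ysT by (metis sorted_list_of_set.idem_if_sorted_distinct strict_sorted_iff)
    have inc': "starts_increasing zs"
      using inc starts_increasing_append_iff[OF split(2-4)] split(1) by blast
    then have zs: "zs \<in> run_sorted_words (set zs)"
      using dist split(1) by (auto simp: run_sorted_words_def permutations_of_set_def)
    have "Min T \<in> set ys"
      using hd_run_sorted_words[OF xs assms(2)] split(1,2) by (metis hd_append2 hd_in_set)
    then have "set zs \<subseteq> T - {Min T}" using ysT set split(1) by auto
    moreover have "Min (set zs) < Max (T - set zs)" if "set zs \<noteq> {}"
    proof -
      have ne: "zs \<noteq> []" using that by auto
      have "hd zs \<le> last ys" using split(4) ne by blast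
      moreover have "hd zs \<noteq> last ys"
        using dist split(1,2) ne by (metis disjoint_iff distinct_append hd_in_set last_in_set)
      moreover have "hd zs = Min (set zs)" using hd_run_sorted_words[OF zs that] .
      moreover have "last ys \<le> Max (T - set zs)" using ysT split(2) by (metis List.finite_set Max_ge last_in_set)
      ultimately show ?thesis by linarith
    qed
    ultimately have "set zs \<in> later_runs_sets T" by (simp add: later_runs_sets_def)
    with zs have "(set zs, zs) \<in> ?P" by simp
    moreover have "?f (set zs, zs) = xs" using ys split(1) by simp
    ultimately show ?thesis by (metis imageI)
  qed
  ultimately show ?thesis by (auto simp: bij_betw_def)
qed

lemma finite_later_runs_sets [simp]: "finite T \<Longrightarrow> finite (later_runs_sets T)"
  by (rule finite_subset[of _ "Pow T"]) (auto simp: later_runs_sets_def)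

lemma run_polynomial_recurrence:
  assumes "finite T" "T \<noteq> {}"
  shows "run_polynomial u T = u * (\<Sum>S\<in>later_runs_sets T. run_polynomial u S)"
proof -
  let ?f = "\<lambda>(S, zs). sorted_list_of_set (T - S) @ zs"
  let ?P = "SIGMA S:later_runs_sets T. run_sorted_words S"
  have "run_polynomial u T = (\<Sum>p\<in>?P. u ^ card (run_starts (?f p)))"
    unfolding run_polynomial_def
    by (rule sum.reindex_bij_betw[OF bij_betw_split_first_run[OF assms], symmetric])
  also have "\<dots> = (\<Sum>(S, zs)\<in>?P. u * u ^ card (run_starts zs))"
  proof (rule sum.cong[OF refl], clarify)
    fix S zs assume S: "S \<in> later_runs_sets T" "zs \<in> run_sorted_words S"
    note F = prepend_first_run[OF assms S]
    show "u ^ card (run_starts (sorted_list_of_set (T - S) @ zs)) = u * u ^ card (run_starts zs)"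
      by (simp add: card_run_starts_append[OF F(1,2,5)])
  qed
  also have "\<dots> = (\<Sum>S\<in>later_runs_sets T. \<Sum>zs\<in>run_sorted_words S. u * u ^ card (run_starts zs))"
    using assms(1) by (subst sum.Sigma) auto
  finally show ?thesis by (simp add: run_polynomial_def sum_distrib_left)
qed

section \<open>Counting the sets of later entries\<close>

text \<open>
  A nonempty \<open>S\<close> fails to give a descent exactly if all of it lies above \<open>T - S\<close>, that is, if it is
  the upper section of \<open>T\<close> at \<open>Min S\<close>.
\<close>

lemma later_runs_sets_eq:
  assumes "finite T" "T \<noteq> {}"
  shows "later_runs_sets T = Pow (T - {Min T}) - (\<lambda>s. {x \<in> T. s \<le> x}) ` (T - {Min T})"
proof -
  have "(S \<noteq> {} \<longrightarrow> Min S < Max (T - S)) \<longleftrightarrow> S \<notin> (\<lambda>s. {x \<in> T. s \<le> x}) ` (T - {Min T})"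
    if S: "S \<subseteq> T - {Min T}" for S
  proof -
    have fin: "finite S" "finite (T - S)" using S assms(1) by (auto intro: finite_subset)
    have ne: "T - S \<noteq> {}" using S assms by (metis Diff_iff Min_in all_not_in_conv insertI1 subsetD)
    have "Min S < Max (T - S)" if "S \<noteq> {}" "S \<notin> (\<lambda>s. {x \<in> T. s \<le> x}) ` (T - {Min T})"
    proof (rule ccontr)
      assume "\<not> Min S < Max (T - S)"
      then have above: "y \<le> Min S" if "y \<in> T - S" for y
        using that fin(2) by (meson Max_ge leI order_trans)
      have m: "Min S \<in> S" using fin that by simp
      have "S = {x \<in> T. Min S \<le> x}"
      proof (intro equalityI subsetI)
        fix x assume "x \<in> S"
        then show "x \<in> {x \<in> T. Min S \<le> x}" using S fin by auto
      next
        fix x assume x: "x \<in> {x \<in> T. Min S \<le> x}"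
        show "x \<in> S"
        proof (rule ccontr)
          assume "x \<notin> S"
          with x above[of x] have "x = Min S" by auto
          with m \<open>x \<notin> S\<close> show False by simp
        qed
      qed
      with m S that(2) show False by blast
    qed
    moreover have "S \<noteq> {} \<and> \<not> Min S < Max (T - S)"
      if upper: "S \<in> (\<lambda>s. {x \<in> T. s \<le> x}) ` (T - {Min T})"
    proof -
      obtain s where s: "s \<in> T" "S = {x \<in> T. s \<le> x}" using upper by auto
      then have "S \<noteq> {}" by auto
      moreover have "Max (T - S) < s" using Max_in[OF fin(2) ne] s(2) by auto
      moreover have "s \<le> Min S" using s(2) fin(1) \<open>S \<noteq> {}\<close> by auto
      ultimately show ?thesis by simp
    qed
    ultimately show ?thesis by blast
  qed
  then show ?thesis unfolding later_runs_sets_def by blast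
qed

text \<open>
  A set of size \<open>k\<close> has exactly one nonempty upper section of each size from \<open>1\<close> to \<open>k\<close>. In the
  induction, a new minimum adds only the whole set as an upper section.
\<close>

lemma sum_card_upper_sets:
  fixes T :: "'b::linorder set" and g :: "nat \<Rightarrow> 'a::comm_monoid_add"
  assumes "finite T"
  shows "(\<Sum>s\<in>T. g (card {x \<in> T. s \<le> x})) = (\<Sum>m=1..card T. g m)"
  using assms
proof (induction T rule: finite_linorder_min_induct)
  case (insert b T)
  have "b \<notin> T" using insert.hyps by auto
  have "{x \<in> insert b T. b \<le> x} = insert b T" using insert.hyps by auto
  moreover have "{x \<in> insert b T. s \<le> x} = {x \<in> T. s \<le> x}" if "s \<in> T" for s
    using insert.hyps that by auto
  ultimately show ?case
    using insert \<open>b \<notin> T\<close> by (simp add: add.commute cong: sum.cong_simp)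
qed simp

lemma sum_Pow_card:
  fixes g :: "nat \<Rightarrow> 'a::comm_semiring_1"
  assumes "finite T"
  shows "(\<Sum>S\<in>Pow T. g (card S)) = (\<Sum>m\<le>card T. of_nat (card T choose m) * g m)"
proof -
  have "(\<Sum>S\<in>Pow T. g (card S)) = (\<Sum>m\<le>card T. \<Sum>S\<in>{S \<in> Pow T. card S = m}. g (card S))"
    using assms by (intro sum.group[symmetric]) (auto intro: card_mono)
  also have "\<dots> = (\<Sum>m\<le>card T. of_nat (card T choose m) * g m)"
    using n_subsets[OF assms] by (intro sum.cong) auto
  finally show ?thesis .
qed

lemma sum_later_runs_sets:
  fixes g :: "nat \<Rightarrow> 'a::comm_ring_1"
  assumes "finite T" "T \<noteq> {}"
  shows "(\<Sum>S\<in>later_runs_sets T. g (card S)) =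
    (\<Sum>m\<le>card T - 1. of_nat ((card T - 1) choose m) * g m) - (\<Sum>m=1..card T - 1. g m)"
proof -
  let ?T' = "T - {Min T}" and ?up = "\<lambda>s. {x \<in> T. s \<le> x}"
  have fin: "finite ?T'" and card: "card ?T' = card T - 1"
    using assms by (auto simp: card_Diff_singleton)
  have up: "?up s = {x \<in> ?T'. s \<le> x}" if "s \<in> ?T'" for s
    using that assms by (auto simp: antisym)
  have inj: "inj_on ?up ?T'"
  proof (rule inj_onI)
    fix s t assume st: "s \<in> ?T'" "t \<in> ?T'" "?up s = ?up t"
    then have "s \<in> ?up t" "t \<in> ?up s" by auto
    then show "s = t" by simp
  qed
  have "(\<Sum>S\<in>later_runs_sets T. g (card S)) =
    (\<Sum>S\<in>Pow ?T'. g (card S)) - (\<Sum>S\<in>?up ` ?T'. g (card S))"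
    unfolding later_runs_sets_eq[OF assms]
  proof (rule sum_diff)
    show "?up ` ?T' \<subseteq> Pow ?T'" using up by auto
  qed (use fin in simp)
  also have "(\<Sum>S\<in>?up ` ?T'. g (card S)) = (\<Sum>s\<in>?T'. g (card {x \<in> ?T'. s \<le> x}))"
    unfolding sum.reindex[OF inj] o_def by (rule sum.cong) (simp_all only: up)
  finally show ?thesis
    using sum_card_upper_sets[OF fin, of g] sum_Pow_card[OF fin, of g] card by simp
qed

section \<open>Complementary Bell numbers\<close>

text \<open>
  Pascal's rule splits the recurrence for \<open>compl_bell (Suc (Suc n))\<close> into the one for
  \<open>compl_bell (Suc n)\<close> and the sum on the right.
\<close>

lemma compl_bell_diff:
  "compl_bell (Suc n) - compl_bell (Suc (Suc n)) = (\<Sum>m\<le>n. int (n choose m) * compl_bell (Suc m))"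
proof -
  have "(\<Sum>i\<le>Suc n. int (Suc n choose i) * compl_bell i) =
    1 + (\<Sum>i\<le>n. int (n choose Suc i) * compl_bell (Suc i)) + (\<Sum>i\<le>n. int (n choose i) * compl_bell (Suc i))"
    by (subst sum.atMost_Suc_shift) (simp add: algebra_simps sum.distrib del: compl_bell.simps(2))
  also have "1 + (\<Sum>i\<le>n. int (n choose Suc i) * compl_bell (Suc i)) =
    (\<Sum>i\<le>Suc n. int (n choose i) * compl_bell i)"
    by (subst sum.atMost_Suc_shift) (simp del: compl_bell.simps(2))
  also have "\<dots> = (\<Sum>i\<le>n. int (n choose i) * compl_bell i)" by (simp del: compl_bell.simps(2))
  finally show ?thesis by simp
qed

lemma run_polynomial_minus_one:
  assumes "finite T" "T \<noteq> {}"
  shows "run_polynomial (-1) T = compl_bell (card T) - compl_bell (Suc (card T))"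
  using assms
proof (induction "card T" arbitrary: T rule: less_induct)
  case less
  define b where "b m = compl_bell m - compl_bell (Suc m)" for m
  obtain k where k: "card T = Suc k" using less.prems by (cases "card T") auto
  have empty: "{} \<in> later_runs_sets T" by (simp add: later_runs_sets_def)
  have IH: "run_polynomial (-1) S = b (card S)" if "S \<in> later_runs_sets T - {{}}" for S
  proof -
    have "S \<subset> T" using that Min_in[OF less.prems] by (auto simp: later_runs_sets_def)
    then show ?thesis
      using less.hyps[of S] that less.prems psubset_card_mono finite_subset[of S T]
      by (auto simp: b_def)
  qed
  (* The empty set contributes 1 to the recurrence, whereas b 0 = 2. *)
  have "b 0 = 2" by (simp add: b_def)
  have "(\<Sum>S\<in>later_runs_sets T. run_polynomial (-1::int) S) =
    1 + (\<Sum>S\<in>later_runs_sets T - {{}}. b (card S))"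
    using IH less.prems empty by (simp add: sum.remove[OF _ empty])
  also have "\<dots> = (\<Sum>S\<in>later_runs_sets T. b (card S)) - 1"
    using less.prems \<open>b 0 = 2\<close> by (simp add: sum.remove[OF _ empty])
  also have "\<dots> = (\<Sum>m\<le>k. int (k choose m) * b m) - (\<Sum>m=1..k. b m) - 1"
    using sum_later_runs_sets[OF less.prems, of b] k by simp
  also have "(\<Sum>m=1..k. b m) = - 1 - compl_bell (Suc k)"
    by (induction k) (auto simp: b_def simp del: compl_bell.simps(2), simp)
  also have "(\<Sum>m\<le>k. int (k choose m) * b m) =
    - compl_bell (Suc k) - (\<Sum>m\<le>k. int (k choose m) * compl_bell (Suc m))"
    unfolding b_def right_diff_distrib sum_subtractf by simp
  finally show ?case
    unfolding run_polynomial_recurrence[OF less.prems, of "-1"] k compl_bell_diff by simp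
qed

lemma RS_even_minus_RS_odd:
  "int (card (RS_even n)) - int (card (RS_odd n)) = (\<Sum>\<pi>\<in>RS n. (-1) ^ run_count \<pi>)"
proof -
  have fin: "finite (RS n)" by (simp add: RS_def)
  have "RS n = RS_even n \<union> RS_odd n" "RS_even n \<inter> RS_odd n = {}"
    by (auto simp: RS_even_def RS_odd_def)
  moreover from this have "finite (RS_even n)" "finite (RS_odd n)"
    using fin by auto
  ultimately have "(\<Sum>\<pi>\<in>RS n. (-1::int) ^ run_count \<pi>) =
    (\<Sum>\<pi>\<in>RS_even n. (-1) ^ run_count \<pi>) + (\<Sum>\<pi>\<in>RS_odd n. (-1) ^ run_count \<pi>)"
    by (simp add: sum.union_disjoint)
  also have "\<dots> = (\<Sum>\<pi>\<in>RS_even n. 1) + (\<Sum>\<pi>\<in>RS_odd n. - 1)"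
    by (intro arg_cong2[of _ _ _ _ "(+)"] sum.cong) (auto simp: RS_even_def RS_odd_def)
  finally show ?thesis by simp
qed

theorem proposition2p4:
  fixes n :: nat
  assumes "n \<ge> 1"
  shows "A n (1::int) (-1) = int (card (RS_even n)) - int (card (RS_odd n)) \<and>
         int (card (RS_even n)) - int (card (RS_odd n)) = compl_bell n - compl_bell (n + 1)"
proof -
  have "A n (1::int) (-1) = (\<Sum>\<pi>\<in>RS n. (-1) ^ run_count \<pi>)"
    by (simp add: A_def)
  moreover have "(\<Sum>\<pi>\<in>RS n. (-1::int) ^ run_count \<pi>) = run_polynomial (-1) {1..n}"
    by (simp add: RS_eq_run_sorted_words[OF assms] run_polynomial_def run_count_eq)
  moreover have "\<dots> = compl_bell n - compl_bell (n + 1)"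
    using run_polynomial_minus_one[of "{1..n}"] assms by (simp del: compl_bell.simps)
  ultimately show ?thesis by (simp del: compl_bell.simps add: RS_even_minus_RS_odd)
qed

end
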